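(* Let $a_0\in\{1,-1\}$, let $a_1,a_3,a_5,\dots$ (all odd-indexed $a_{2m+1}$, $m\ge 0$) be arbitrary real numbers, and let $b_i=(-1)^i a_0$ for $i\ge 0$ (so $b_{2m}=a_0$ and $b_{2m+1}=-b_{2m}$). Let $t(i,j)$ be the zero-sum triangle (defined in the context) with left boundary $(a_i)$ and right boundary $(b_i)$, where the even-indexed left boundary values $a_{2m}$, $m\ge1$, are determined recursively by $$a_{2m}=-\frac{a_0}{2}\sum_{k=1}^{2m-1}t(2m,k)a_k$$ (the right-hand side depends only on $a_1,\dots,a_{2m-1}$ and $b_0,\dots,b_{2m}$). For $n\ge 1$ let $T_n$ be the $n\times n$ lower triangular matrix with $T_n(i+1,j+1)=t(i,j)$ for $0\le j\le i\le n-1$ and zeros above the diagonal. Then $T_n^2=I$ for every $n\ge1$. Moreover, with $s_0(i)=\sum_{k=0}^{i}t(i,k)a_k$, $s_1(i)=\sum_{k=0}^{i}t(i,k)a_{k+1}$, $s_{-1}(i)=\sum_{k=1}^{i}t(i,k)a_{k-1}$, one has $s_0(0)=1$, $s_1(0)=a_0a_1$, $s_{-1}(1)=-1$, and for all $i\ge1$: $$s_0(i)=0,\qquad s_1(i)=a_0\{a_i+a_{i+1}\},\qquad s_{-1}(i)=(-1)^i.$$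
   Context: Zero-sum triangle: given sequences $(a_i)_{i\ge0}$, $(b_i)_{i\ge0}$ with $b_0=a_0$, define numbers $t(i,j)$ for integers $0\le j\le i$ by $t(i,0)=a_i$ for $i\ge 0$, $t(i,i)=b_i$ for $i\ge 1$, and for $0<j<i$ by the zero-sum rule $t(i,j)+t(i-1,j-1)+t(i-1,j)=0$, i.e. $t(i,j)=-t(i-1,j-1)-t(i-1,j)$. *)

theory Defs
  imports Complex_Main "Jordan_Normal_Form.Matrix"
begin

text \<open>The zero-sum triangle with left boundary \<open>a\<close> and right boundary \<open>b\<close>. Only the entries with
  \<open>j \<le> i\<close> are meaningful; the entries with \<open>j > i\<close> are set to \<open>0\<close>. The apex is \<open>a 0\<close>, so \<open>b 0\<close>
  is never consulted.\<close>

fun zero_sum_triangle :: "(nat \<Rightarrow> real) \<Rightarrow> (nat \<Rightarrow> real) \<Rightarrow> nat \<Rightarrow> nat \<Rightarrow> real" where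
  "zero_sum_triangle a b i 0 = a i"
| "zero_sum_triangle a b 0 (Suc j) = 0"
| "zero_sum_triangle a b (Suc i) (Suc j) =
     (if j = i then b (Suc i)
      else if j < i then - zero_sum_triangle a b i j - zero_sum_triangle a b i (Suc j)
      else 0)"

text \<open>\<open>a\<close> is a left boundary with apex \<open>a0\<close>, prescribed odd-indexed values \<open>c\<close>, and even-indexed
  values given by the recursion. In the recursion the triangle is built from \<open>a\<close> itself, but its
  entries \<open>(2m, k)\<close> with \<open>1 \<le> k < 2m\<close> involve only the values of \<open>a\<close> at indices
  \<open>1, \<dots>, 2m - 1\<close>, so this is a genuine recursion for \<open>a (2m)\<close>.\<close>

definition recursive_left_boundary ::
    "real \<Rightarrow> (nat \<Rightarrow> real) \<Rightarrow> (nat \<Rightarrow> real) \<Rightarrow> (nat \<Rightarrow> real) \<Rightarrow> bool" where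
  "recursive_left_boundary a0 c b a \<longleftrightarrow>
     a 0 = a0 \<and>
     (\<forall>m. a (2 * m + 1) = c m) \<and>
     (\<forall>m\<ge>1. a (2 * m) = - (a0 / 2) * (\<Sum>k = 1..2 * m - 1. zero_sum_triangle a b (2 * m) k * a k))"

definition triangle_mat :: "(nat \<Rightarrow> nat \<Rightarrow> real) \<Rightarrow> nat \<Rightarrow> real mat" where
  "triangle_mat t n = mat n n (\<lambda>(i, j). if j \<le> i then t i j else 0)"

definition s_zero :: "(nat \<Rightarrow> nat \<Rightarrow> real) \<Rightarrow> (nat \<Rightarrow> real) \<Rightarrow> nat \<Rightarrow> real" where
  "s_zero t a i = (\<Sum>k = 0..i. t i k * a k)"

definition s_plus :: "(nat \<Rightarrow> nat \<Rightarrow> real) \<Rightarrow> (nat \<Rightarrow> real) \<Rightarrow> nat \<Rightarrow> real" where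
  "s_plus t a i = (\<Sum>k = 0..i. t i k * a (k + 1))"

definition s_minus :: "(nat \<Rightarrow> nat \<Rightarrow> real) \<Rightarrow> (nat \<Rightarrow> real) \<Rightarrow> nat \<Rightarrow> real" where
  "s_minus t a i = (\<Sum>k = 1..i. t i k * a (k - 1))"

end

theory Submission
  imports Defs
begin

text \<open>Since \<open>b\<close> alternates, the zero-sum rule also holds on the diagonal, and therefore for all
  \<open>i, j \<ge> 1\<close> when the triangle is padded with zeros. Applying it to both factors of
  \<open>P i j = (\<Sum>k. t i k * t k j)\<close> gives \<open>P (i + 1) (j + 1) = P i j\<close>: the square of the triangle is
  constant along diagonals, so it is the identity as soon as its first column \<open>s_zero\<close> is.
  The recursion for \<open>a (2 * m)\<close> says exactly that \<open>s_zero\<close> vanishes at \<open>2 * m\<close>. At the first odd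
  index \<open>i\<close> where it could fail to vanish, comparing the \<open>(i, 0)\<close> entries of \<open>T * T\<^sup>2 = T\<^sup>2 * T\<close>
  yields \<open>t i i * P i 0 = P i 0 * t 0 0\<close> with \<open>t i i = - t 0 0\<close>, so \<open>P i 0 = 0\<close>.\<close>

locale zero_sum_array =
  fixes t :: "nat \<Rightarrow> nat \<Rightarrow> real"
  assumes upper: "i < j \<Longrightarrow> t i j = 0"
    and rule: "t (Suc i) (Suc j) = - t i j - t i (Suc j)"
begin

definition sq :: "nat \<Rightarrow> nat \<Rightarrow> real" where
  "sq i j = (\<Sum>k\<le>i. t i k * t k j)"

lemma diagonal: "t i i = (-1) ^ i * t 0 0"
  by (induction i) (auto simp: rule upper)

lemma row_sum_extend: "i \<le> n \<Longrightarrow> (\<Sum>k\<le>i. t i k * f k) = (\<Sum>k\<le>n. t i k * f k)"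
  by (rule sum.mono_neutral_left) (auto simp: upper)

text \<open>The right-hand sum can still run to \<open>i\<close>, since its last term contains
  \<open>t i (Suc i) = 0\<close>. This matches the second sum in
  \<open>sum_next_row\<close>.\<close>

lemma row_sum_shift: "(\<Sum>k\<le>i. t i k * f k) = t i 0 * f 0 + (\<Sum>k\<le>i. t i (Suc k) * f (Suc k))"
proof -
  have "(\<Sum>k\<le>i. t i k * f k) = (\<Sum>k\<le>Suc i. t i k * f k)"
    by (rule row_sum_extend) simp
  also have "\<dots> = t i 0 * f 0 + (\<Sum>k\<le>i. t i (Suc k) * f (Suc k))"
    by (rule sum.atMost_Suc_shift)
  finally show ?thesis .
qed

lemma sum_next_row:
  "(\<Sum>k\<le>i. t (Suc i) (Suc k) * f k) = - (\<Sum>k\<le>i. t i k * f k) - (\<Sum>k\<le>i. t i (Suc k) * f k)"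
  by (simp add: rule algebra_simps sum.distrib sum_negf sum_subtractf)

lemma sq_Suc_Suc: "sq (Suc i) (Suc j) = sq i j"
proof -
  have "sq (Suc i) (Suc j) = (\<Sum>k\<le>i. t (Suc i) (Suc k) * t (Suc k) (Suc j))"
    unfolding sq_def by (subst sum.atMost_Suc_shift) (simp add: upper)
  also have "\<dots> = - (\<Sum>k\<le>i. t i k * t (Suc k) (Suc j)) - (\<Sum>k\<le>i. t i (Suc k) * t (Suc k) (Suc j))"
    by (rule sum_next_row)
  \<comment> \<open>The left factor is expanded already; expanding the right one below gives a
    second \<open>sq i (Suc j)\<close> of opposite sign, and only \<open>sq i j\<close>
    survives.\<close>
  also have "(\<Sum>k\<le>i. t i (Suc k) * t (Suc k) (Suc j)) = sq i (Suc j)"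
    unfolding sq_def using row_sum_shift[of i "\<lambda>k. t k (Suc j)"] by (simp add: upper)
  also have "(\<Sum>k\<le>i. t i k * t (Suc k) (Suc j)) = - sq i j - sq i (Suc j)"
    by (simp add: sq_def rule algebra_simps sum.distrib sum_negf sum_subtractf)
  finally show ?thesis by simp
qed

lemma sq_add: "sq (d + j) j = sq d 0"
  by (induction j) (auto simp: sq_Suc_Suc)

lemma sq_upper: "i < j \<Longrightarrow> sq i j = 0"
  unfolding sq_def by (intro sum.neutral) (auto simp: upper)

lemma sq_commutes: "(\<Sum>k\<le>i. t i k * sq k 0) = (\<Sum>k\<le>i. sq i k * t k 0)"
proof -
  have "(\<Sum>k\<le>i. t i k * sq k 0) = (\<Sum>k\<le>i. \<Sum>l\<le>i. t i k * (t k l * t l 0))"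
    unfolding sq_def by (intro sum.cong refl) (simp add: row_sum_extend[of _ i] sum_distrib_left)
  also have "\<dots> = (\<Sum>l\<le>i. \<Sum>k\<le>i. t i k * (t k l * t l 0))"
    by (rule sum.swap)
  also have "\<dots> = (\<Sum>k\<le>i. sq i k * t k 0)"
    by (simp add: sq_def sum_distrib_right mult.assoc)
  finally show ?thesis .
qed

context
  assumes apex: "t 0 0 * t 0 0 = 1"
    and even_zero: "\<And>i. even i \<Longrightarrow> i > 0 \<Longrightarrow> sq i 0 = 0"
begin

lemma sq_0_0: "sq 0 0 = 1"
  using apex by (simp add: sq_def)

lemma sq_column_zero: "i > 0 \<Longrightarrow> sq i 0 = 0"
proof (induction i rule: less_induct)
  case (less i)
  show ?case
  proof (cases "even i")
    case False
    then obtain n where i: "i = Suc n" by (cases i) auto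
    have low: "sq k 0 = (if k = 0 then 1 else 0)" if "k \<le> n" for k
      using that less.IH[of k] i by (auto simp: sq_0_0)
    \<comment> \<open>By constancy along diagonals this entry is \<open>sq (n - k) 0\<close>, so the
      induction hypothesis on the first column also settles row \<open>i\<close>, except for
      \<open>sq i 0\<close>.\<close>
    have row: "sq i (Suc k) = (if k = n then 1 else 0)" if "k \<le> n" for k
      using sq_add[of "n - k" "Suc k"] low[of "n - k"] that i by auto
    \<comment> \<open>Besides the unknown \<open>sq i 0\<close>, each side of
      \<open>sq_commutes\<close> retains just the term \<open>t i 0\<close>, and these
      cancel.\<close>
    have "(\<Sum>k\<le>i. t i k * sq k 0) = (\<Sum>k\<le>n. if k = 0 then t i k else 0) + t i i * sq i 0"
      unfolding i sum.atMost_Suc by (intro arg_cong2[where f="(+)"] sum.cong) (auto simp: low)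
    moreover have "(\<Sum>k\<le>i. sq i k * t k 0) = sq i 0 * t 0 0 + (\<Sum>k\<le>n. if k = n then t i 0 else 0)"
      unfolding i sum.atMost_Suc_shift
      by (intro arg_cong2[where f="(+)"] sum.cong) (auto simp: row[unfolded i])
    ultimately have "t i i * sq i 0 = sq i 0 * t 0 0"
      using sq_commutes[of i] by auto
    moreover have "t i i = - t 0 0" using False diagonal[of i] by simp
    ultimately show ?thesis using apex by auto
  qed (use less even_zero in auto)
qed

lemma sq_identity: "sq i j = (if i = j then 1 else 0)"
proof (cases "j \<le> i")
  case True
  then show ?thesis
    using sq_add[of "i - j" j] sq_column_zero[of "i - j"] by (auto simp: sq_0_0)
qed (auto simp: sq_upper)

lemma triangle_mat_square: "triangle_mat t n ^\<^sub>m 2 = 1\<^sub>m n"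
proof -
  have mat: "triangle_mat t n = mat n n (\<lambda>(i, j). t i j)"
    unfolding triangle_mat_def by (intro cong_mat) (auto simp: upper)
  have "triangle_mat t n ^\<^sub>m 2 = triangle_mat t n * triangle_mat t n"
    by (simp add: numeral_2_eq_2 mat)
  also have "\<dots> = 1\<^sub>m n"
  proof (rule eq_matI)
    fix i j assume "i < dim_row (1\<^sub>m n :: real mat)" "j < dim_col (1\<^sub>m n :: real mat)"
    then have ij: "i < n" "j < n" by auto
    then have "(triangle_mat t n * triangle_mat t n) $$ (i, j) = (\<Sum>k = 0..<n. t i k * t k j)"
      by (simp add: mat scalar_prod_def)
    also have "\<dots> = sq i j"
      \<comment> \<open>The matrix product sums over all \<open>k < n\<close>; terms with
        \<open>k > i\<close> vanish.\<close>
      unfolding sq_def using ij by (intro sum.mono_neutral_right) (auto simp: upper)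
    finally show "(triangle_mat t n * triangle_mat t n) $$ (i, j) = 1\<^sub>m n $$ (i, j)"
      using ij by (simp add: sq_identity)
  qed (auto simp: mat)
  finally show ?thesis .
qed

text \<open>\<open>sum_next_row\<close> with weights \<open>t k 0\<close> turns each new sum into
  minus \<open>sq (Suc i) 0\<close>, which is zero, minus the previous sum. Hence the sign flips
  from row to row.\<close>

lemma column_sum_minus: "(\<Sum>k\<le>i. t (Suc i) (Suc k) * t k 0) = (-1) ^ Suc i"
proof (induction i)
  case 0
  show ?case using apex by (simp add: diagonal[of "Suc 0"])
next
  case (Suc i)
  have "(\<Sum>k\<le>Suc i. t (Suc i) (Suc k) * t k 0) = (\<Sum>k\<le>i. t (Suc i) (Suc k) * t k 0)"
    by (simp add: upper)
  then show ?case
    using Suc sq_column_zero[of "Suc i"] by (simp only: sum_next_row sq_def) simp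
qed

text \<open>Removing the \<open>k = 0\<close> terms from the vanishing sums
  \<open>sq (Suc i) 0\<close> and \<open>sq i 0\<close> evaluates two of the three sums in
  \<open>sum_next_row\<close>, with weights \<open>t (Suc k) 0\<close>; the third is the one
  wanted.\<close>

lemma column_sum_plus:
  assumes "i > 0"
  shows "(\<Sum>k\<le>i. t i k * t (Suc k) 0) = t 0 0 * (t i 0 + t (Suc i) 0)"
proof -
  have "0 = t (Suc i) 0 * t 0 0 + (\<Sum>k\<le>i. t (Suc i) (Suc k) * t (Suc k) 0)"
    using sq_column_zero[of "Suc i"] unfolding sq_def sum.atMost_Suc_shift by simp
  moreover have "0 = t i 0 * t 0 0 + (\<Sum>k\<le>i. t i (Suc k) * t (Suc k) 0)"
    using sq_column_zero[OF assms] row_sum_shift[of i "\<lambda>k. t k 0"] by (simp add: sq_def)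
  ultimately show ?thesis
    unfolding sum_next_row by (simp add: algebra_simps)
qed

end

end

lemma zero_sum_triangle_upper: "i < j \<Longrightarrow> zero_sum_triangle a b i j = 0"
  by (cases i; cases j) auto

lemma zero_sum_triangle_diag: "b 0 = a 0 \<Longrightarrow> zero_sum_triangle a b i i = b i"
  by (cases i) auto

lemma zero_sum_array_zero_sum_triangle:
  assumes "b 0 = a 0" and "\<And>i. b (Suc i) = - b i"
  shows "zero_sum_array (zero_sum_triangle a b)"
proof
  fix i j
  show "zero_sum_triangle a b (Suc i) (Suc j)
      = - zero_sum_triangle a b i j - zero_sum_triangle a b i (Suc j)"
    using assms by (cases i j rule: linorder_cases)
      (auto simp: zero_sum_triangle_upper zero_sum_triangle_diag)
qed (rule zero_sum_triangle_upper)

text \<open>From a column \<open>k > 0\<close> the rule reaches column \<open>0\<close> only in an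
  earlier row, so \<open>a i\<close> itself is never consulted. This makes the recursion for the
  even-indexed values well-founded.\<close>

lemma zero_sum_triangle_cong:
  assumes "\<And>j. j < i \<Longrightarrow> a j = a' j" and "k > 0"
  shows "zero_sum_triangle a b i k = zero_sum_triangle a' b i k"
  using assms
proof (induction i arbitrary: k)
  case 0
  then show ?case by (cases k) auto
next
  case (Suc i)
  then obtain j where k: "k = Suc j" by (cases k) auto
  have "zero_sum_triangle a b i j = zero_sum_triangle a' b i j"
    using Suc by (cases j) auto
  then show ?case using Suc.IH[of "Suc j"] Suc.prems by (simp add: k)
qed

text \<open>The triangle takes a whole sequence as argument, so the guards \<open>i < n\<close> and
  \<open>k < n\<close> are what makes every recursive call visibly smaller.
  \<open>zero_sum_triangle_cong\<close> removes the first guard again.\<close>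

fun left_boundary :: "real \<Rightarrow> (nat \<Rightarrow> real) \<Rightarrow> (nat \<Rightarrow> real) \<Rightarrow> nat \<Rightarrow> real" where
  "left_boundary a0 c b n =
     (if n = 0 then a0
      else if odd n then c (n div 2)
      else - (a0 / 2) * (\<Sum>k = 1..n - 1.
        zero_sum_triangle (\<lambda>i. if i < n then left_boundary a0 c b i else 0) b n k *
        (if k < n then left_boundary a0 c b k else 0)))"

declare left_boundary.simps [simp del]

lemma recursive_left_boundary_exists: "recursive_left_boundary a0 c b (left_boundary a0 c b)"
  unfolding recursive_left_boundary_def
proof (intro conjI allI impI)
  fix m :: nat assume "m \<ge> 1"
  then show "left_boundary a0 c b (2 * m) = - (a0 / 2) *
      (\<Sum>k = 1..2 * m - 1. zero_sum_triangle (left_boundary a0 c b) b (2 * m) k * left_boundary a0 c b k)"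
    by (subst left_boundary.simps)
      (auto intro!: sum.cong arg_cong2[where f="(*)"] zero_sum_triangle_cong)
qed (simp_all add: left_boundary.simps)

lemma recursive_left_boundary_unique:
  assumes a: "recursive_left_boundary a0 c b a" and a': "recursive_left_boundary a0 c b a'"
  shows "a = a'"
proof
  fix n
  show "a n = a' n"
  proof (induction n rule: less_induct)
    case (less n)
    consider "n = 0" | m where "n = 2 * m + 1" | m where "n = 2 * m" "m \<ge> 1"
      by (metis One_nat_def Suc_leI gr0I mult_0_right oddE evenE)
    then show ?case
    proof cases
      case 3
      then have "(\<Sum>k = 1..2 * m - 1. zero_sum_triangle a b (2 * m) k * a k)
          = (\<Sum>k = 1..2 * m - 1. zero_sum_triangle a' b (2 * m) k * a' k)"
        by (intro sum.cong refl arg_cong2[where f="(*)"] zero_sum_triangle_cong less.IH) auto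
      then show ?thesis
        using a a' 3 by (simp add: recursive_left_boundary_def)
    qed (use a a' in \<open>auto simp: recursive_left_boundary_def\<close>)
  qed
qed

theorem theorem2:
  fixes a0 :: real and c b :: "nat \<Rightarrow> real"
  assumes "a0 \<in> {1, -1}"
    and "\<And>i. b i = (-1) ^ i * a0"
  shows "(\<exists>!a. recursive_left_boundary a0 c b a) \<and>
    (\<forall>a t. recursive_left_boundary a0 c b a \<and> t = zero_sum_triangle a b \<longrightarrow>
       (\<forall>n\<ge>1. triangle_mat t n ^\<^sub>m 2 = 1\<^sub>m n) \<and>
       s_zero t a 0 = 1 \<and> s_plus t a 0 = a 0 * a 1 \<and> s_minus t a 1 = -1 \<and>
       (\<forall>i\<ge>1. s_zero t a i = 0 \<and>
               s_plus t a i = a 0 * (a i + a (i + 1)) \<and>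
               s_minus t a i = (-1) ^ i))"
proof (intro conjI[of "\<exists>!a. recursive_left_boundary a0 c b a"] allI impI, goal_cases)
  case 1
  show ?case
    using recursive_left_boundary_exists recursive_left_boundary_unique by blast
next
  case (2 a t)
  then have rlb: "recursive_left_boundary a0 c b a" and t: "t = zero_sum_triangle a b"
    by auto
  then have a_0: "a 0 = a0" by (simp add: recursive_left_boundary_def)
  interpret zero_sum_array t
    unfolding t by (rule zero_sum_array_zero_sum_triangle) (simp_all add: assms(2) a_0)
  have col: "t i 0 = a i" for i by (simp add: t)
  have apex: "t 0 0 * t 0 0 = 1" using assms(1) by (auto simp: col a_0)
  have even_zero: "sq i 0 = 0" if i: "even i" "i > 0" for i
  proof -
    obtain m where m: "i = 2 * m" "m \<ge> 1" using i by (auto elim!: evenE)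
    \<comment> \<open>The end terms \<open>k = 0\<close> and \<open>k = i\<close> each contribute
      \<open>a0 * a i\<close>, as \<open>t i i = a0\<close> for even \<open>i\<close>. The factor
      \<open>- (a0 / 2)\<close> in the recursion, with \<open>a0 * a0 = 1\<close>, makes their total
      cancel the inner sum.\<close>
    have "{..i} = insert 0 (insert i {1..i - 1})" using i by auto
    then have "sq i 0 = a i * a0 + t i i * a i + (\<Sum>k = 1..i - 1. t i k * a k)"
      using i by (simp add: sq_def col a_0)
    moreover have "a i = - (a0 / 2) * (\<Sum>k = 1..i - 1. t i k * a k)"
      using rlb m unfolding recursive_left_boundary_def t by blast
    moreover have "t i i = a0" using i diagonal[of i] by (simp add: col a_0)
    ultimately show ?thesis using assms(1) by auto
  qed
  note square = apex even_zero
  have zero: "s_zero t a i = sq i 0" for i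
    by (simp add: s_zero_def sq_def col atLeast0AtMost)
  have plus: "s_plus t a i = (\<Sum>k\<le>i. t i k * t (Suc k) 0)" for i
    by (simp add: s_plus_def col atLeast0AtMost)
  have minus: "s_minus t a (Suc i) = (\<Sum>k\<le>i. t (Suc i) (Suc k) * t k 0)" for i
    unfolding s_minus_def One_nat_def sum.shift_bounds_cl_Suc_ivl
    by (simp add: col atLeast0AtMost)
  have minus': "s_minus t a i = (-1) ^ i" if "i \<ge> 1" for i
    using that column_sum_minus[OF square] minus by (cases i) auto
  have "s_plus t a i = a 0 * (a i + a (i + 1))" if "i \<ge> 1" for i
    using column_sum_plus[OF square] that by (simp add: plus col)
  moreover have "s_zero t a i = 0" if "i \<ge> 1" for i
    using sq_column_zero[OF square] that by (simp add: zero)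
  moreover have "s_plus t a 0 = a 0 * a 1" by (simp add: plus col)
  moreover have "s_zero t a 0 = 1" using sq_0_0[OF square] by (simp add: zero)
  ultimately show ?case
    using triangle_mat_square[OF square] minus' by simp
qed

end
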